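(* For $|q|<1$, $$\sum_{n\ge 0}\frac{q^{n(n+1)/2}(-1;q)_n}{(q;q^2)_n(q;q)_n}=\frac{(q^5,q^5,q^{10};q^{10})_\infty(-q;q)_\infty}{(q;q)_\infty}.$$
   Context: $(x;q)_m=\prod_{j=0}^{m-1}(1-xq^j)$, $(x;q)_\infty=\prod_{j=0}^\infty(1-xq^j)$, and $(x_1,\dots,x_p;q)_\infty=(x_1;q)_\infty\cdots(x_p;q)_\infty$. *)

theory Defs
  imports "HOL-Analysis.Analysis"
begin

definition qpoch :: "complex \<Rightarrow> complex \<Rightarrow> nat \<Rightarrow> complex" where
  "qpoch x q m = (\<Prod>j<m. 1 - x * q ^ j)"

(* For norm q < 1 the product converges in the sense of convergent_prod (zero factors
   are allowed), so prodinf is then its genuine value. *)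
definition qpoch_inf :: "complex \<Rightarrow> complex \<Rightarrow> complex" where
  "qpoch_inf x q = (\<Prod>j. 1 - x * q ^ j)"

definition qpoch_inf_list :: "complex list \<Rightarrow> complex \<Rightarrow> complex" where
  "qpoch_inf_list xs q = (\<Prod>x\<leftarrow>xs. qpoch_inf x q)"

end

theory Submission
  imports Defs
begin

text \<open>
  Write \<open>(x)\<^sub>n\<close> for \<open>(x;q)\<^sub>n\<close>. The identity is an instance of Bailey's method with parameter \<open>a = 1\<close>.
  Its summand is \<open>w\<^sub>n * \<beta>\<^sub>n\<close> with weight \<open>w\<^sub>n = q^(n(n+1)/2) (-1)\<^sub>n\<close> and
  \<open>\<beta>\<^sub>n = 1 / ((q;q^2)\<^sub>n (q)\<^sub>n)\<close>, and three facts combine.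

  \<^item> The numbers \<open>\<beta>\<^sub>n\<close> belong to a Bailey pair of Slater whose \<open>\<alpha>\<close> lives on even indices:
    \<open>\<beta>\<^sub>n = \<Sum>r\<in>\<int>. c(r) / ((q)_(n-2r) (q)_(n+2r))\<close> with
    \<open>c(r) = (-1)^r q^(3r^2) (q^r + q^(-r)) / 2\<close> (lemma \<open>bailey_pair\<close>).
  \<^item> Interchanging the two sums leaves \<open>\<Sum>n. w\<^sub>n / ((q)_(n-k) (q)_(n+k))\<close> at \<open>k = 2r\<close>. This is a
    summable basic hypergeometric series \<open>1\<phi>1\<close>, with value
    \<open>2 q^(k(k+1)/2) / (1 + q^k)\<close> times \<open>(-q)\<^sub>\<infinity> / (q)\<^sub>\<infinity>\<close> (lemmas \<open>phi_1_1_sum\<close> and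
    \<open>conjugate_bailey_pair\<close>).
  \<^item> The factor \<open>1 + q^(2r)\<close> in the denominator cancels against \<open>c(r)\<close>, so that only
    \<open>\<Sum>r\<in>\<int>. (-1)^r q^(5r^2)\<close> remains, and Gauss's special case of the Jacobi triple product turns
    this theta series into \<open>(q^5, q^5, q^10; q^10)\<^sub>\<infinity>\<close> (lemma \<open>gauss_theta\<close>).

  The Bailey pair and a finite form of Gauss's identity are both proved by creative telescoping in
  the style of Zeilberger: the summand \<open>f(n,r)\<close> satisfies a first-order recurrence in \<open>n\<close> up to a
  difference \<open>G(r+1) - G(r)\<close>, and such a difference sums to zero over \<open>\<int>\<close>. Passages to the limit use
  dominated convergence for unconditional sums. The case \<open>q = 0\<close> is separate, because negative
  powers of \<open>q\<close> occur throughout.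
\<close>

section \<open>Convergence of q-Pochhammer symbols\<close>

lemma qpoch_0 [simp]: "qpoch x q 0 = 1"
  by (simp add: qpoch_def)

lemma qpoch_Suc: "qpoch x q (Suc n) = qpoch x q n * (1 - x * q ^ n)"
  by (simp add: qpoch_def)

lemma qpoch_add: "qpoch x q (m + n) = qpoch x q m * qpoch (x * q ^ m) q n"
  by (induction n) (simp_all add: qpoch_Suc power_add mult_ac)

lemma qpoch_zero_left [simp]: "qpoch 0 q n = 1"
  by (simp add: qpoch_def)

lemma convergent_prod_qpoch:
  fixes x q :: complex
  assumes "norm q < 1"
  shows "convergent_prod (\<lambda>j. 1 - x * q ^ j)"
proof -
  have "summable (\<lambda>j. norm x * norm q ^ j)"
    using assms by (intro summable_mult summable_geometric) auto
  hence "summable (\<lambda>j. norm (1 - x * q ^ j - 1))"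
    by (simp add: norm_mult norm_power)
  thus ?thesis
    using abs_convergent_prod_conv_summable abs_convergent_prod_imp_convergent_prod by blast
qed

lemma qpoch_tendsto:
  assumes "norm q < 1"
  shows "qpoch x q \<longlonglongrightarrow> qpoch_inf x q"
proof -
  have "(\<lambda>n. \<Prod>j\<le>n. 1 - x * q ^ j) \<longlonglongrightarrow> qpoch_inf x q"
    unfolding qpoch_inf_def by (rule convergent_prod_LIMSEQ [OF convergent_prod_qpoch [OF assms]])
  hence "(\<lambda>n. qpoch x q (Suc n)) \<longlonglongrightarrow> qpoch_inf x q"
    by (simp add: qpoch_def lessThan_Suc_atMost)
  thus ?thesis
    by (rule LIMSEQ_imp_Suc)
qed

lemma qpoch_inf_split:
  assumes "norm q < 1"
  shows "qpoch_inf x q = qpoch x q n * qpoch_inf (x * q ^ n) q"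
proof -
  have "(\<lambda>m. qpoch x q n * qpoch (x * q ^ n) q m) \<longlonglongrightarrow> qpoch x q n * qpoch_inf (x * q ^ n) q"
    by (intro tendsto_intros qpoch_tendsto assms)
  hence "(\<lambda>m. qpoch x q (m + n)) \<longlonglongrightarrow> qpoch x q n * qpoch_inf (x * q ^ n) q"
    by (subst add.commute) (simp add: qpoch_add)
  moreover have "(\<lambda>m. qpoch x q (m + n)) \<longlonglongrightarrow> qpoch_inf x q"
    using qpoch_tendsto [OF assms] by (rule LIMSEQ_ignore_initial_segment)
  ultimately show ?thesis
    using LIMSEQ_unique by blast
qed

lemma norm_mult_power_less_1:
  fixes x q :: complex
  assumes "norm q < 1" "norm x < 1"
  shows "norm (x * q ^ n) < 1"
proof -
  have "norm x * norm q ^ n \<le> norm x"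
    using assms by (intro mult_left_le power_le_one) auto
  thus ?thesis
    using assms by (simp add: norm_mult norm_power)
qed

lemma qpoch_factor_nonzero:
  fixes x q :: complex
  assumes "norm q < 1" "norm x < 1"
  shows "1 - x * q ^ j \<noteq> 0"
  using norm_mult_power_less_1 [OF assms, of j] by auto

lemma qpoch_nonzero:
  assumes "norm q < 1" "norm x < 1"
  shows "qpoch x q n \<noteq> 0"
  using qpoch_factor_nonzero [OF assms] by (simp add: qpoch_def)

lemma qpoch_inf_nonzero:
  assumes "norm q < 1" "norm x < 1"
  shows "qpoch_inf x q \<noteq> 0"
  unfolding qpoch_inf_def
  by (intro prodinf_nonzero convergent_prod_qpoch qpoch_factor_nonzero assms)

lemma qpoch_bounded:
  assumes "norm q < 1"
  obtains M where "M > 0" "\<And>n. norm (qpoch x q n) \<le> M"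
  using convergent_imp_Bseq [OF convergentI [OF qpoch_tendsto [OF assms, of x]]]
  by (auto simp: Bseq_def)

lemma inverse_qpoch_bounded:
  assumes "norm q < 1" "norm x < 1"
  obtains M where "M > 0" "\<And>n. norm (1 / qpoch x q n) \<le> M"
proof -
  have "(\<lambda>n. 1 / qpoch x q n) \<longlonglongrightarrow> 1 / qpoch_inf x q"
    by (intro tendsto_intros qpoch_tendsto qpoch_inf_nonzero assms)
  from convergent_imp_Bseq [OF convergentI [OF this]] show ?thesis
    using that by (auto simp: Bseq_def)
qed

section \<open>Unconditional sums\<close>

lemma has_sum_telescope:
  fixes g :: "int \<Rightarrow> complex"
  assumes "finite {k. g k \<noteq> 0}"
  shows "((\<lambda>k. g (k + 1) - g k) has_sum 0) UNIV"
proof -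
  have g: "(g has_sum (\<Sum>k\<in>{k. g k \<noteq> 0}. g k)) UNIV"
    using assms by (intro has_sum_finite_neutralI) auto
  have "bij (\<lambda>k::int. k + 1)"
    by (rule bij_betw_byWitness [where f' = "\<lambda>k. k - 1"]) auto
  with g have "((\<lambda>k. g (k + 1)) has_sum (\<Sum>k\<in>{k. g k \<noteq> 0}. g k)) UNIV"
    using has_sum_reindex_bij_betw [of "\<lambda>k::int. k + 1" UNIV UNIV g] by blast
  moreover have "((\<lambda>k. - g k) has_sum - (\<Sum>k\<in>{k. g k \<noteq> 0}. g k)) UNIV"
    using g by (simp add: has_sum_uminus)
  ultimately show ?thesis
    using has_sum_add by fastforce
qed

text \<open>
  Dominated convergence for unconditional sums over an arbitrary index set: the bound makes the
  partial sums converge uniformly in \<open>n\<close>, so the two limits may be interchanged.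
\<close>

lemma has_sum_tannery:
  fixes f :: "nat \<Rightarrow> 'a \<Rightarrow> complex"
  assumes sums: "\<And>n. (f n has_sum S n) A"
    and bound: "\<And>n x. x \<in> A \<Longrightarrow> norm (f n x) \<le> M x"
    and M: "M summable_on A"
    and lim: "\<And>x. x \<in> A \<Longrightarrow> (\<lambda>n. f n x) \<longlonglongrightarrow> g x"
    and S: "S \<longlonglongrightarrow> L"
  shows "(g has_sum L) A"
proof -
  have "norm (g x) \<le> M x" if "x \<in> A" for x
    using tendsto_norm [OF lim [OF that]] bound [OF that]
    by (intro Lim_bounded) auto
  with M have "(\<lambda>x. norm (g x)) summable_on A"
    by (rule Infinite_Sum.abs_summable_on_comparison_test')
  hence g: "(g has_sum infsum g A) A"
    by (rule has_sum_infsum [OF Infinite_Sum.abs_summable_summable])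
  have "S \<longlonglongrightarrow> infsum g A"
  proof (rule swap_uniform_limit')
    show "uniform_limit UNIV (\<lambda>X n. \<Sum>x\<in>X. f n x) S (finite_subsets_at_top A)"
      using bound sums M by (intro Weierstrass_m_test_general') auto
    show "((\<lambda>X. \<Sum>x\<in>X. g x) \<longlongrightarrow> infsum g A) (finite_subsets_at_top A)"
      using g by (simp add: has_sum_def)
    show "\<forall>\<^sub>F X in finite_subsets_at_top A.
            ((\<lambda>n. \<Sum>x\<in>X. f n x) \<longlonglongrightarrow> (\<Sum>x\<in>X. g x))"
      by (intro eventually_finite_subsets_at_top_weakI tendsto_sum lim) auto
  qed auto
  with S g show ?thesis
    using LIMSEQ_unique by blast
qed

lemma summable_on_power_abs_int:
  fixes c :: real
  assumes "0 \<le> c" "c < 1"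
  shows "(\<lambda>k::int. c ^ nat \<bar>k\<bar>) summable_on UNIV"
proof -
  have nat: "(\<lambda>n. c ^ n) summable_on UNIV"
    using assms by (intro norm_summable_imp_summable_on) (simp add: summable_geometric)
  have "(\<lambda>k::int. c ^ nat \<bar>k\<bar>) summable_on range int"
    using nat by (subst summable_on_reindex) (auto simp: o_def)
  moreover have "(\<lambda>k::int. c ^ nat \<bar>k\<bar>) summable_on range (\<lambda>n. - int n)"
    using nat by (subst summable_on_reindex) (auto simp: o_def inj_on_def)
  ultimately have "(\<lambda>k::int. c ^ nat \<bar>k\<bar>) summable_on (range int \<union> range (\<lambda>n. - int n))"
    by (rule summable_on_union)
  also have "range int \<union> range (\<lambda>n. - int n) = UNIV"
    by (metis (no_types, lifting) UNIV_eq_I UnI1 UnI2 int_cases2 rangeI)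
  finally show ?thesis .
qed

section \<open>Reciprocals of q-factorials at integer arguments\<close>

text \<open>
  The value \<open>0\<close> at negative arguments is that of the convention \<open>1 / (q;q)\<^sub>k = 0\<close> for \<open>k < 0\<close>. It truncates
  sums over all integers automatically and is forced by the recurrence \<open>inv_qfact_pred\<close>, whose
  factor \<open>1 - q^k\<close> vanishes at \<open>k = 0\<close>.
\<close>

definition inv_qfact :: "complex \<Rightarrow> int \<Rightarrow> complex" where
  "inv_qfact q k = (if k < 0 then 0 else 1 / qpoch q q (nat k))"

lemma inv_qfact_of_nat [simp]: "inv_qfact q (int n) = 1 / qpoch q q n"
  by (simp add: inv_qfact_def)

lemma inv_qfact_neg [simp]: "k < 0 \<Longrightarrow> inv_qfact q k = 0"
  by (simp add: inv_qfact_def)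

lemma inv_qfact_pred:
  assumes "norm q < 1" "q \<noteq> 0"
  shows "inv_qfact q (k - 1) = (1 - q powi k) * inv_qfact q k"
proof (cases "k > 0")
  case True
  then obtain m where k: "k = int (Suc m)"
    by (metis not0_implies_Suc of_nat_0 pos_int_cases order_less_irrefl)
  have "q powi k = q * q ^ m"
    unfolding k power_int_of_nat by simp
  moreover have "1 - q * q ^ m \<noteq> 0" "qpoch q q m \<noteq> 0"
    by (rule qpoch_factor_nonzero qpoch_nonzero; fact assms)+
  ultimately show ?thesis
    by (simp add: k inv_qfact_def qpoch_Suc nat_add_distrib)
next
  case False
  thus ?thesis
    by (cases "k = 0") auto
qed

lemma inv_qfact_bounded:
  assumes "norm q < 1"
  obtains M where "M > 0" "\<And>k. norm (inv_qfact q k) \<le> M"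
proof -
  obtain M where "M > 0" "\<And>n. norm (1 / qpoch q q n) \<le> M"
    using inverse_qpoch_bounded [OF assms assms] by blast
  thus ?thesis
    by (intro that [of M]) (auto simp: inv_qfact_def)
qed

section \<open>The Bailey pair\<close>

text \<open>
  Slater's sequence has the terms \<open>(-1)^r q^(3r^2) (q^r + q^(-r))\<close> at the even indices \<open>2r > 0\<close>. Here each
  term is shared equally between \<open>r\<close> and \<open>-r\<close>. The sum then runs over all integers with no exceptional
  term at \<open>r = 0\<close>, and the symmetry under \<open>r \<mapsto> -r\<close> is what lets a first-order recurrence telescope:
  it makes the two outer powers of \<open>q^r\<close> in the certificate below match.
\<close>

definition bailey_alpha :: "complex \<Rightarrow> int \<Rightarrow> complex" where
  "bailey_alpha q r = (-1) powi r * q powi (3 * r\<^sup>2) * (q powi r + q powi (- r)) / 2"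

text \<open>
  The rational function identity behind the telescoping recurrence of \<open>bailey_pair\<close>, with
  \<open>w = q^r\<close> and \<open>Z = q^(n-1)\<close>. Both sides are invariant under \<open>w \<mapsto> 1/w\<close>.
  The monomials \<open>w^3\<close> and \<open>1/w^3\<close> on the right come from \<open>G(r+1)\<close> and \<open>G(r)\<close>: the left-hand side has
  degrees \<open>-3\<close> to \<open>3\<close> in \<open>w\<close>, which leaves no other choice of a monomial for \<open>G\<close>.
\<close>

lemma bailey_pair_certificate:
  fixes w q Z :: complex
  assumes "w \<noteq> 0"
  shows "(1 - q * Z\<^sup>2) * (1 - q * Z) * ((w + 1 / w) / 2)
           - (w + 1 / w) / 2 * ((1 - q * Z / w\<^sup>2) * (1 - q * Z * w\<^sup>2))
         = q * Z / 2 * w ^ 3 * ((1 - Z / w\<^sup>2) * (1 - q * Z / w\<^sup>2))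
           + q * Z / 2 / w ^ 3 * ((1 - Z * w\<^sup>2) * (1 - q * Z * w\<^sup>2))"
  using assms by (simp add: field_simps power2_eq_square power3_eq_cube)

text \<open>
  Induction on \<open>n\<close>: with \<open>f(n,r)\<close> the summand, the quantity
  \<open>(1 - q^(2n-1)) (1 - q^n) f(n,r) - f(n-1,r)\<close> is a difference \<open>G(r+1) - G(r)\<close> of a finitely
  supported function, so the sums satisfy the recurrence of \<open>1 / ((q;q^2)\<^sub>n (q)\<^sub>n)\<close>.
\<close>

lemma bailey_pair:
  assumes q: "norm q < 1" "q \<noteq> 0"
  shows "((\<lambda>r. bailey_alpha q r * (inv_qfact q (int n - 2 * r) * inv_qfact q (int n + 2 * r)))
            has_sum (1 / (qpoch q (q\<^sup>2) n * qpoch q q n))) UNIV"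
proof (induction n)
  case 0
  have "inv_qfact q (- 2 * r) * inv_qfact q (2 * r) = 0" if "r \<noteq> 0" for r
    using that by (cases "r < 0") auto
  thus ?case
    by (intro has_sum_finite_neutralI [of "{0}"]) (auto simp: bailey_alpha_def inv_qfact_def)
next
  case (Suc m)
  define Z where "Z = q ^ m"
  define f where "f = (\<lambda>n r. bailey_alpha q r * (inv_qfact q (int n - 2 * r) * inv_qfact q (int n + 2 * r)))"
  define G where "G = (\<lambda>r. - (q * Z / 2) * (-1) powi r * q powi (3 * r\<^sup>2 - 3 * r) *
                          (inv_qfact q (int (Suc m) - 2 * r) * inv_qfact q (int (Suc m) + 2 * r - 2)))"
  have step: "(1 - q * Z\<^sup>2) * (1 - q * Z) * f (Suc m) r = f m r + (G (r + 1) - G r)" for r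
  proof -
    define w U s A B where "w = q powi r" and "U = q powi (3 * r\<^sup>2)" and "s = (-1 :: complex) powi r"
      and "A = inv_qfact q (int (Suc m) - 2 * r)" and "B = inv_qfact q (int (Suc m) + 2 * r)"
    have w: "w \<noteq> 0"
      using q by (simp add: w_def)
    have wpow: "q powi (2 * r) = w\<^sup>2" "q powi (3 * r) = w ^ 3"
      by (simp_all add: w_def power_int_power' mult.commute flip: power_int_mult)
    have minus: "q powi (int m - 2 * r) = Z / w\<^sup>2" "q powi (int m - 2 * r + 1) = q * Z / w\<^sup>2"
      using q by (simp_all add: power_int_diff power_int_add Z_def wpow)
    have plus: "q powi (int m + 2 * r) = Z * w\<^sup>2" "q powi (int m + 2 * r + 1) = q * Z * w\<^sup>2"
      using q by (simp_all add: power_int_add Z_def wpow)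
    have A1: "inv_qfact q (int m - 2 * r) = (1 - q * Z / w\<^sup>2) * A"
      using inv_qfact_pred [OF q, of "int m - 2 * r + 1"] unfolding minus A_def by (simp add: algebra_simps)
    have A2: "inv_qfact q (int m - 2 * r - 1) = (1 - Z / w\<^sup>2) * ((1 - q * Z / w\<^sup>2) * A)"
      using inv_qfact_pred [OF q, of "int m - 2 * r"] by (simp add: A1 minus)
    have B1: "inv_qfact q (int m + 2 * r) = (1 - q * Z * w\<^sup>2) * B"
      using inv_qfact_pred [OF q, of "int m + 2 * r + 1"] unfolding plus B_def by (simp add: algebra_simps)
    have B2: "inv_qfact q (int m + 2 * r - 1) = (1 - Z * w\<^sup>2) * ((1 - q * Z * w\<^sup>2) * B)"
      using inv_qfact_pred [OF q, of "int m + 2 * r"] by (simp add: B1 plus)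
    have alpha: "bailey_alpha q r = s * U * ((w + 1 / w) / 2)"
      by (simp add: bailey_alpha_def s_def U_def w_def power_int_minus field_simps)
    have G0: "G r = - (s * U * A * B * (q * Z / 2 / w ^ 3 * ((1 - Z * w\<^sup>2) * (1 - q * Z * w\<^sup>2))))"
    proof -
      have "q powi (3 * r\<^sup>2 - 3 * r) = U / w ^ 3"
        using q by (simp add: power_int_diff U_def wpow)
      moreover have "int (Suc m) + 2 * r - 2 = int m + 2 * r - 1"
        by simp
      ultimately show ?thesis
        by (simp only: G_def s_def A_def B2) (simp add: mult_ac)
    qed
    have G1: "G (r + 1) = s * U * A * B * (q * Z / 2 * w ^ 3 * ((1 - Z / w\<^sup>2) * (1 - q * Z / w\<^sup>2)))"
    proof -
      have "3 * (r + 1)\<^sup>2 - 3 * (r + 1) = 3 * r\<^sup>2 + 3 * r"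
        by (simp add: power2_eq_square algebra_simps)
      hence "q powi (3 * (r + 1)\<^sup>2 - 3 * (r + 1)) = U * w ^ 3"
        using q by (simp only:) (simp add: power_int_add U_def wpow)
      moreover have "int (Suc m) - 2 * (r + 1) = int m - 2 * r - 1" "int (Suc m) + 2 * (r + 1) - 2 = int (Suc m) + 2 * r"
        by simp_all
      moreover have "(-1) powi (r + 1) = - s"
        by (simp add: s_def power_int_add)
      ultimately show ?thesis
        by (simp only: G_def A2 B_def [symmetric]) simp
    qed
    have "(1 - q * Z\<^sup>2) * (1 - q * Z) * f (Suc m) r - f m r
        = s * U * A * B * ((1 - q * Z\<^sup>2) * (1 - q * Z) * ((w + 1 / w) / 2)
           - (w + 1 / w) / 2 * ((1 - q * Z / w\<^sup>2) * (1 - q * Z * w\<^sup>2)))"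
      unfolding f_def alpha A1 B1 A_def [symmetric] B_def [symmetric] by (simp only: algebra_simps)
    also have "\<dots> = G (r + 1) - G r"
      unfolding bailey_pair_certificate [OF w] G0 G1 by (simp only: distrib_left diff_minus_eq_add)
    finally show ?thesis
      by (simp add: algebra_simps)
  qed
  have "finite {r. G r \<noteq> 0}"
  proof (rule finite_subset)
    show "{r. G r \<noteq> 0} \<subseteq> {- int (Suc m) .. int (Suc m)}"
      by (auto simp: G_def inv_qfact_def split: if_splits)
  qed auto
  from has_sum_add [OF Suc.IH has_sum_telescope [OF this]]
  have "((\<lambda>r. (1 - q * Z\<^sup>2) * (1 - q * Z) * f (Suc m) r) has_sum
           (1 / (qpoch q (q\<^sup>2) m * qpoch q q m))) UNIV"
    unfolding step by (simp add: f_def)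
  moreover have nz: "1 - q * Z\<^sup>2 \<noteq> 0" "1 - q * Z \<noteq> 0"
    using qpoch_factor_nonzero [of q q "2 * m"] qpoch_factor_nonzero [of q q m] q
    by (auto simp: Z_def mult.commute simp flip: power_mult)
  ultimately have "(f (Suc m) has_sum
           (1 / (qpoch q (q\<^sup>2) m * qpoch q q m) / ((1 - q * Z\<^sup>2) * (1 - q * Z)))) UNIV"
    by (subst (asm) has_sum_cmult_right_iff) auto
  thus ?case
    by (simp add: f_def qpoch_Suc Z_def mult_ac power2_eq_square power_mult_distrib)
qed

section \<open>A theta function of Gauss\<close>

text \<open>
  The rational function identity behind the telescoping recurrence of \<open>finite_gauss_theta\<close>, with
  \<open>w = x^k\<close> and \<open>Z = x^(2n-2)\<close>.
\<close>

lemma gauss_theta_certificate: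
  fixes w x Z :: complex
  assumes "w \<noteq> 0"
  shows "(1 + x * Z) * (1 - x ^ 4 * Z\<^sup>2) - (1 - x * Z) * ((1 - x\<^sup>2 * Z / w\<^sup>2) * (1 - x\<^sup>2 * Z * w\<^sup>2))
         = (x * w\<^sup>2) * (Z / w\<^sup>2 + x * Z) * (1 - x\<^sup>2 * Z / w\<^sup>2)
           + (x\<^sup>2 * Z / w\<^sup>2 + x * Z) * (1 - x\<^sup>2 * Z * w\<^sup>2)"
  using assms by (simp add: field_simps power2_eq_square power4_eq_xxxx)

text \<open>
  A finite form of Gauss's identity, which tends to it as \<open>n\<close> grows. The telescoping argument is that of
  \<open>bailey_pair\<close>, now for the recurrence
  \<open>(1 + x^(2n-1)) (1 - x^(4n)) f(n,k) - (1 - x^(2n-1)) f(n-1,k) = G(k+1) - G(k)\<close>.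
\<close>

lemma finite_gauss_theta:
  assumes x: "norm x < 1" "x \<noteq> 0"
  shows "((\<lambda>k. (-1) powi k * x powi k\<^sup>2 *
              (inv_qfact (x\<^sup>2) (int n - k) * inv_qfact (x\<^sup>2) (int n + k)))
           has_sum (qpoch x (x\<^sup>2) n ^ 2 / qpoch (x\<^sup>2) (x\<^sup>2) (2 * n))) UNIV"
proof (induction n)
  case 0
  have "inv_qfact (x\<^sup>2) (- k) * inv_qfact (x\<^sup>2) k = 0" if "k \<noteq> 0" for k
    using that by (cases "k < 0") auto
  thus ?case
    by (intro has_sum_finite_neutralI [of "{0}"]) (auto simp: inv_qfact_def)
next
  case (Suc m)
  have x2: "norm (x\<^sup>2) < 1" "x\<^sup>2 \<noteq> 0"
    using x by (auto simp: norm_power power_less_one_iff)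
  define Z where "Z = x ^ (2 * m)"
  define f where "f = (\<lambda>n k. (-1) powi k * x powi k\<^sup>2 *
              (inv_qfact (x\<^sup>2) (int n - k) * inv_qfact (x\<^sup>2) (int n + k)))"
  define G where "G = (\<lambda>k. - ((-1) powi k) * x powi k\<^sup>2 * (x\<^sup>2 * Z / x powi (2 * k) + x * Z) *
                          (inv_qfact (x\<^sup>2) (int (Suc m) - k) * inv_qfact (x\<^sup>2) (int (Suc m) + k - 1)))"
  have step: "(1 + x * Z) * (1 - x ^ 4 * Z\<^sup>2) * f (Suc m) k = (1 - x * Z) * f m k + (G (k + 1) - G k)" for k
  proof -
    define w U s A B where "w = x powi k" and "U = x powi k\<^sup>2" and "s = (-1 :: complex) powi k"
      and "A = inv_qfact (x\<^sup>2) (int (Suc m) - k)" and "B = inv_qfact (x\<^sup>2) (int (Suc m) + k)"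
    have w: "w \<noteq> 0"
      using x by (simp add: w_def)
    have wpow: "x powi (2 * k) = w\<^sup>2"
      by (simp add: w_def power_int_power' mult.commute flip: power_int_mult)
    have sq: "(x\<^sup>2) powi j = x powi (2 * j)" for j
      by (simp add: power_int_mult)
    have minus: "(x\<^sup>2) powi (int (Suc m) - k) = x\<^sup>2 * Z / w\<^sup>2"
      using x by (simp add: power_int_diff power_int_add Z_def wpow [symmetric] sq [symmetric] power_mult)
    have plus: "(x\<^sup>2) powi (int (Suc m) + k) = x\<^sup>2 * Z * w\<^sup>2"
      using x by (simp add: power_int_add Z_def wpow [symmetric] sq [symmetric] power_mult)
    have A1: "inv_qfact (x\<^sup>2) (int m - k) = (1 - x\<^sup>2 * Z / w\<^sup>2) * A"
      using inv_qfact_pred [OF x2, of "int (Suc m) - k"] unfolding minus A_def by (simp add: algebra_simps)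
    have B1: "inv_qfact (x\<^sup>2) (int m + k) = (1 - x\<^sup>2 * Z * w\<^sup>2) * B"
      using inv_qfact_pred [OF x2, of "int (Suc m) + k"] unfolding plus B_def by (simp add: algebra_simps)
    have G0: "G k = - (s * U * A * B * ((x\<^sup>2 * Z / w\<^sup>2 + x * Z) * (1 - x\<^sup>2 * Z * w\<^sup>2)))"
    proof -
      have "inv_qfact (x\<^sup>2) (int (Suc m) + k - 1) = (1 - x\<^sup>2 * Z * w\<^sup>2) * B"
        by (simp flip: B1)
      thus ?thesis
        by (simp add: G_def wpow s_def U_def A_def)
    qed
    have G1: "G (k + 1) = s * U * A * B * ((x * w\<^sup>2) * (Z / w\<^sup>2 + x * Z) * (1 - x\<^sup>2 * Z / w\<^sup>2))"
    proof -
      have "(k + 1)\<^sup>2 = k\<^sup>2 + (2 * k + 1)"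
        by (simp add: power2_eq_square algebra_simps)
      hence "x powi (k + 1)\<^sup>2 = U * (x * w\<^sup>2)"
        using x by (simp add: power_int_add U_def wpow)
      moreover have "inv_qfact (x\<^sup>2) (int (Suc m) - (k + 1)) = (1 - x\<^sup>2 * Z / w\<^sup>2) * A"
        by (simp flip: A1)
      moreover have "inv_qfact (x\<^sup>2) (int (Suc m) + (k + 1) - 1) = B"
        by (simp add: B_def algebra_simps)
      moreover have "(-1) powi (k + 1) = - s"
        by (simp add: s_def power_int_add)
      moreover have "x\<^sup>2 * Z / x powi (2 * (k + 1)) = Z / w\<^sup>2"
        using x by (simp add: distrib_left power_int_add wpow)
      ultimately show ?thesis
        by (simp only: G_def) simp
    qed
    have "(1 + x * Z) * (1 - x ^ 4 * Z\<^sup>2) * f (Suc m) k - (1 - x * Z) * f m k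
        = s * U * A * B * ((1 + x * Z) * (1 - x ^ 4 * Z\<^sup>2)
            - (1 - x * Z) * ((1 - x\<^sup>2 * Z / w\<^sup>2) * (1 - x\<^sup>2 * Z * w\<^sup>2)))"
      unfolding f_def A1 B1 A_def [symmetric] B_def [symmetric] s_def [symmetric] U_def [symmetric]
      by (simp only: algebra_simps)
    also have "\<dots> = G (k + 1) - G k"
      unfolding gauss_theta_certificate [OF w] G0 G1 by (simp only: distrib_left diff_minus_eq_add)
    finally show ?thesis
      by (simp add: algebra_simps)
  qed
  have "finite {k. G k \<noteq> 0}"
  proof (rule finite_subset)
    show "{k. G k \<noteq> 0} \<subseteq> {- int (Suc m) .. int (Suc m)}"
      by (auto simp: G_def inv_qfact_def split: if_splits)
  qed auto
  from has_sum_add [OF has_sum_cmult_right [OF Suc.IH, of "1 - x * Z"] has_sum_telescope [OF this]]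
  have "((\<lambda>k. (1 + x * Z) * (1 - x ^ 4 * Z\<^sup>2) * f (Suc m) k) has_sum
           ((1 - x * Z) * (qpoch x (x\<^sup>2) m ^ 2 / qpoch (x\<^sup>2) (x\<^sup>2) (2 * m)))) UNIV"
    unfolding step by (simp add: f_def)
  moreover have Zpow: "x\<^sup>2 * (x\<^sup>2) ^ Suc (2 * m) = x ^ 4 * Z\<^sup>2" "x\<^sup>2 * (x\<^sup>2) ^ (2 * m) = (x * Z)\<^sup>2"
  proof -
    have "(x\<^sup>2) ^ (2 * m) = Z\<^sup>2"
      by (simp add: Z_def mult.commute flip: power_mult)
    thus "x\<^sup>2 * (x\<^sup>2) ^ Suc (2 * m) = x ^ 4 * Z\<^sup>2" "x\<^sup>2 * (x\<^sup>2) ^ (2 * m) = (x * Z)\<^sup>2"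
      by (simp_all add: power2_eq_square power4_eq_xxxx mult_ac)
  qed
  moreover have nz: "1 - x ^ 4 * Z\<^sup>2 \<noteq> 0" "(1 + x * Z) * (1 - x * Z) \<noteq> 0"
  proof -
    have "1 - x\<^sup>2 * (x\<^sup>2) ^ Suc (2 * m) \<noteq> 0" "1 - x\<^sup>2 * (x\<^sup>2) ^ (2 * m) \<noteq> 0"
      using qpoch_factor_nonzero x2 by blast+
    thus "1 - x ^ 4 * Z\<^sup>2 \<noteq> 0" "(1 + x * Z) * (1 - x * Z) \<noteq> 0"
      unfolding Zpow by (simp_all add: power2_eq_square algebra_simps)
  qed
  ultimately have *: "(f (Suc m) has_sum
           ((1 - x * Z) * (qpoch x (x\<^sup>2) m ^ 2 / qpoch (x\<^sup>2) (x\<^sup>2) (2 * m))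
              / ((1 + x * Z) * (1 - x ^ 4 * Z\<^sup>2)))) UNIV"
    by (subst (asm) has_sum_cmult_right_iff) auto
  have num: "qpoch x (x\<^sup>2) (Suc m) = qpoch x (x\<^sup>2) m * (1 - x * Z)"
    by (simp add: qpoch_Suc Z_def power_mult)
  from Zpow have "qpoch (x\<^sup>2) (x\<^sup>2) (2 * Suc m)
           = qpoch (x\<^sup>2) (x\<^sup>2) (2 * m) * ((1 + x * Z) * (1 - x * Z)) * (1 - x ^ 4 * Z\<^sup>2)"
    by (simp add: qpoch_Suc) (simp add: algebra_simps power2_eq_square)
  hence "(1 - x * Z) * (qpoch x (x\<^sup>2) m ^ 2 / qpoch (x\<^sup>2) (x\<^sup>2) (2 * m))
              / ((1 + x * Z) * (1 - x ^ 4 * Z\<^sup>2))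
        = qpoch x (x\<^sup>2) (Suc m) ^ 2 / qpoch (x\<^sup>2) (x\<^sup>2) (2 * Suc m)"
    using nz by (simp add: num divide_simps) (simp add: power2_eq_square mult_ac)
  with * show ?case
    by (simp add: f_def)
qed

lemma gauss_theta:
  assumes x: "norm x < 1" "x \<noteq> 0"
  shows "((\<lambda>k. (-1) powi k * x powi k\<^sup>2)
           has_sum (qpoch_inf x (x\<^sup>2) ^ 2 * qpoch_inf (x\<^sup>2) (x\<^sup>2))) UNIV"
proof -
  have x2: "norm (x\<^sup>2) < 1"
    using x by (auto simp: norm_power power_less_one_iff)
  define P where "P = qpoch_inf (x\<^sup>2) (x\<^sup>2)"
  have P: "P \<noteq> 0"
    unfolding P_def using x2 by (intro qpoch_inf_nonzero) auto
  obtain M where M: "M > 0" "\<And>k. norm (inv_qfact (x\<^sup>2) k) \<le> M"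
    using inv_qfact_bounded [OF x2] by blast
  have "((\<lambda>k. (-1) powi k * x powi k\<^sup>2 * (1 / P * (1 / P))) has_sum (qpoch_inf x (x\<^sup>2) ^ 2 / P)) UNIV"
  proof (rule has_sum_tannery [OF finite_gauss_theta [OF x]])
    show "(\<lambda>k::int. M * M * norm x ^ nat \<bar>k\<bar>) summable_on UNIV"
      using x by (intro summable_on_cmult_right summable_on_power_abs_int) auto
    show "norm ((-1) powi k * x powi k\<^sup>2 *
            (inv_qfact (x\<^sup>2) (int n - k) * inv_qfact (x\<^sup>2) (int n + k)))
          \<le> M * M * norm x ^ nat \<bar>k\<bar>" for n k
    proof -
      have "k\<^sup>2 = int (nat \<bar>k\<bar> ^ 2)"
        by simp
      hence "x powi k\<^sup>2 = x ^ (nat \<bar>k\<bar> ^ 2)"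
        by (metis power_int_of_nat)
      moreover have "norm x ^ (nat \<bar>k\<bar> ^ 2) \<le> norm x ^ nat \<bar>k\<bar>"
        using x by (intro power_decreasing) (auto simp: power2_eq_square)
      ultimately have "norm (x powi k\<^sup>2) \<le> norm x ^ nat \<bar>k\<bar>"
        by (simp add: norm_power)
      moreover have "norm (inv_qfact (x\<^sup>2) (int n - k) * inv_qfact (x\<^sup>2) (int n + k)) \<le> M * M"
        unfolding norm_mult using M by (intro mult_mono) (auto intro: less_imp_le)
      ultimately have "norm (x powi k\<^sup>2) * norm (inv_qfact (x\<^sup>2) (int n - k) * inv_qfact (x\<^sup>2) (int n + k))
                        \<le> norm x ^ nat \<bar>k\<bar> * (M * M)"
        by (intro mult_mono) auto
      thus ?thesis
        by (simp add: norm_mult norm_power_int mult_ac)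
    qed
    have lim: "(\<lambda>n. inv_qfact (x\<^sup>2) (int n + k)) \<longlonglongrightarrow> 1 / P" for k
    proof -
      \<comment> \<open>The offset skips the arguments \<open>n + k < 0\<close>, at which the reciprocal is zero by convention.\<close>
      have "(\<lambda>n. inv_qfact (x\<^sup>2) (int (n + nat (- k)) + k)) \<longlonglongrightarrow> 1 / P"
      proof -
        have "inv_qfact (x\<^sup>2) (int (n + nat (- k)) + k) = 1 / qpoch (x\<^sup>2) (x\<^sup>2) (n + nat k)" for n
          by (simp add: inv_qfact_def nat_add_distrib flip: of_nat_add) (auto simp: nat_add_distrib)
        moreover have "(\<lambda>n. qpoch (x\<^sup>2) (x\<^sup>2) (n + nat k)) \<longlonglongrightarrow> P"
          unfolding P_def by (intro LIMSEQ_ignore_initial_segment qpoch_tendsto x2)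
        ultimately show ?thesis
          using P by (simp only:) (intro tendsto_divide tendsto_const)
      qed
      thus ?thesis
        by (rule LIMSEQ_offset)
    qed
    show "(\<lambda>n. (-1) powi k * x powi k\<^sup>2 *
            (inv_qfact (x\<^sup>2) (int n - k) * inv_qfact (x\<^sup>2) (int n + k)))
          \<longlonglongrightarrow> (-1) powi k * x powi k\<^sup>2 * (1 / P * (1 / P))" for k
      using lim [of k] lim [of "- k"] by (intro tendsto_intros) auto
    show "(\<lambda>n. qpoch x (x\<^sup>2) n ^ 2 / qpoch (x\<^sup>2) (x\<^sup>2) (2 * n)) \<longlonglongrightarrow> qpoch_inf x (x\<^sup>2) ^ 2 / P"
    proof -
      have "filterlim (\<lambda>n::nat. 2 * n) sequentially sequentially"
        by (intro filterlim_subseq) (auto simp: strict_mono_def)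
      hence "(\<lambda>n. qpoch (x\<^sup>2) (x\<^sup>2) (2 * n)) \<longlonglongrightarrow> P"
        unfolding P_def by (rule filterlim_compose [OF qpoch_tendsto [OF x2]])
      thus ?thesis
        using P by (intro tendsto_intros qpoch_tendsto x2)
    qed
  qed
  from has_sum_cmult_right [OF this, of "P * P"] show ?thesis
    using P by (simp add: P_def mult_ac power2_eq_square)
qed

section \<open>A summable basic hypergeometric series\<close>

text \<open>
  The terms of \<open>1\<phi>1(a; ab; q, b)\<close>. Taking \<open>b\<close> and not the lower parameter \<open>ab\<close> as the basic variable
  avoids the quotient \<open>c / a\<close> of the customary form \<open>1\<phi>1(a; c; q, c/a)\<close>, so \<open>b = 0\<close> is a regular point.
\<close>

definition phi_term :: "complex \<Rightarrow> complex \<Rightarrow> complex \<Rightarrow> nat \<Rightarrow> complex" where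
  "phi_term a b q m = qpoch a q m * (- b) ^ m * q ^ (m choose 2) / (qpoch q q m * qpoch (a * b) q m)"

lemma phi_term_bound:
  assumes q: "norm q < 1" and b: "norm b < 1" "norm (a * b) < 1"
  shows "\<exists>K. \<forall>N m. norm (phi_term a (b * q ^ N) q m) \<le> K * norm b ^ m"
proof -
  obtain K1 where K1: "K1 > 0" "\<And>m. norm (qpoch a q m) \<le> K1"
    using qpoch_bounded [OF q] by blast
  obtain K2 where K2: "K2 > 0" "\<And>m. norm (1 / qpoch q q m) \<le> K2"
    using inverse_qpoch_bounded [OF q q] by blast
  obtain K3 where K3: "K3 > 0" "\<And>m. norm (qpoch (a * b) q m) \<le> K3"
    using qpoch_bounded [OF q] by blast
  obtain K4 where K4: "K4 > 0" "\<And>m. norm (1 / qpoch (a * b) q m) \<le> K4"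
    using inverse_qpoch_bounded [OF q b(2)] by blast
  show ?thesis
  proof (intro exI allI)
    fix N m
    have nz: "qpoch (a * b) q n \<noteq> 0" for n
      by (rule qpoch_nonzero [OF q b(2)])
    \<comment> \<open>A shifted product is a quotient of two unshifted ones, which makes its bound uniform in \<open>N\<close>.\<close>
    have "1 / qpoch (a * b * q ^ N) q m = qpoch (a * b) q N * (1 / qpoch (a * b) q (N + m))"
      using nz [of N] by (simp add: qpoch_add)
    hence denom: "norm (1 / qpoch (a * b * q ^ N) q m) \<le> K3 * K4"
      by (simp only: norm_mult) (intro mult_mono K3 K4 norm_ge_zero less_imp_le)
    have "norm (b * q ^ N) \<le> norm b"
      using q by (simp add: norm_mult norm_power mult_left_le power_le_one)
    hence "norm ((- (b * q ^ N)) ^ m) \<le> norm b ^ m"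
      by (simp only: norm_power norm_minus_cancel power_mono norm_ge_zero)
    moreover have "norm (q ^ (m choose 2)) \<le> 1"
      using q by (simp add: norm_power power_le_one)
    ultimately have "norm (qpoch a q m) * norm (1 / qpoch q q m) * norm (1 / qpoch (a * b * q ^ N) q m)
                 * (norm ((- (b * q ^ N)) ^ m) * norm (q ^ (m choose 2))) \<le> K1 * K2 * (K3 * K4) * (norm b ^ m * 1)"
      using K1 K2 K3 K4 denom
      by (intro mult_mono mult_nonneg_nonneg zero_le_power norm_ge_zero) (auto intro: less_imp_le)
    also have "norm (qpoch a q m) * norm (1 / qpoch q q m) * norm (1 / qpoch (a * b * q ^ N) q m)
                 * (norm ((- (b * q ^ N)) ^ m) * norm (q ^ (m choose 2))) = norm (phi_term a (b * q ^ N) q m)"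
      unfolding phi_term_def norm_mult [symmetric] by (intro arg_cong [where f = norm]) (simp add: mult_ac)
    finally show "norm (phi_term a (b * q ^ N) q m) \<le> K1 * K2 * (K3 * K4) * norm b ^ m"
      by simp
  qed
qed

text \<open>
  Since \<open>q^m t(m) + (1 - q^(m+1)) t(m+1) = t(m) - (g(m) - g(m+1))\<close> for \<open>g(m) = (1 - q^m) t(m)\<close>, where
  \<open>g(0) = 0\<close>, summing this relation over \<open>m\<close> gives \<open>(1 - ab) F(b) = (1 - b) F(bq)\<close> for the sum
  \<open>F(b)\<close> of the series.
\<close>

lemma phi_term_contiguous:
  assumes q: "norm q < 1" and b: "norm (a * b) < 1"
  shows "(1 - a * b) * (q ^ m * phi_term a b q m + (1 - q ^ Suc m) * phi_term a b q (Suc m))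
           = (1 - b) * phi_term a (b * q) q m"
proof -
  define N D C where "N = qpoch a q m * (- b) ^ m * q ^ (m choose 2)" and "D = qpoch q q m"
    and "C = qpoch (a * b * q) q m"
  have nz: "1 - a * b \<noteq> 0" "1 - a * b * q ^ m \<noteq> 0" "1 - q ^ Suc m \<noteq> 0" "D \<noteq> 0"
    using qpoch_factor_nonzero [OF q b, of 0] qpoch_factor_nonzero [OF q b, of m]
      qpoch_factor_nonzero [OF q q, of m] qpoch_nonzero [OF q q] by (simp_all add: D_def)
  have shift: "qpoch (a * b) q (Suc m) = (1 - a * b) * C"
    using qpoch_add [of "a * b" q 1 m] by (simp add: C_def qpoch_Suc)
  have "C \<noteq> 0"
    using qpoch_nonzero [OF q b, of "Suc m"] shift by auto
  have "qpoch (a * b) q m = (1 - a * b) * C / (1 - a * b * q ^ m)"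
    using nz by (simp add: qpoch_Suc flip: shift)
  hence t0: "phi_term a b q m = N * (1 - a * b * q ^ m) / (D * ((1 - a * b) * C))"
    by (simp add: phi_term_def N_def D_def)
  have "Suc m choose 2 = m + (m choose 2)"
    by (simp add: numeral_2_eq_2)
  hence t1: "phi_term a b q (Suc m) = - (N * (1 - a * q ^ m) * b * q ^ m) / (D * (1 - q ^ Suc m) * ((1 - a * b) * C))"
    by (simp add: phi_term_def shift) (simp add: qpoch_Suc N_def D_def power_add mult_ac)
  have t2: "phi_term a (b * q) q m = N * q ^ m / (D * C)"
  proof -
    have "(- (b * q)) ^ m = (- b) ^ m * q ^ m"
      by (metis mult_minus_left power_mult_distrib)
    thus ?thesis
      by (simp add: phi_term_def N_def D_def C_def mult_ac)
  qed
  have "(1 - q ^ Suc m) * phi_term a b q (Suc m) = - (N * (1 - a * q ^ m) * b * q ^ m) / (D * ((1 - a * b) * C))"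
    using nz \<open>C \<noteq> 0\<close> unfolding t1 by (simp del: power_Suc)
  hence "(1 - a * b) * (q ^ m * phi_term a b q m + (1 - q ^ Suc m) * phi_term a b q (Suc m))
       = (q ^ m * (N * (1 - a * b * q ^ m)) - N * (1 - a * q ^ m) * b * q ^ m) / (D * C)"
    using nz \<open>C \<noteq> 0\<close> unfolding t0 by (simp add: divide_simps)
  also have "q ^ m * (N * (1 - a * b * q ^ m)) - N * (1 - a * q ^ m) * b * q ^ m = (1 - b) * (N * q ^ m)"
    by (simp add: algebra_simps)
  finally show ?thesis
    by (simp add: t2)
qed

text \<open>
  Iterating the relation between \<open>F(b)\<close> and \<open>F(bq)\<close> gives \<open>(ab)\<^sub>N F(b) = (b)\<^sub>N F(b q^N)\<close>, and
  \<open>F(b q^N) \<longlonglongrightarrow> F(0) = 1\<close> by dominated convergence.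
\<close>

lemma phi_1_1_sum:
  assumes q: "norm q < 1" and b: "norm b < 1" "norm (a * b) < 1"
  shows "(phi_term a b q has_sum (qpoch_inf b q / qpoch_inf (a * b) q)) UNIV"
proof -
  define F where "F = (\<lambda>c. infsum (phi_term a c q) UNIV)"
  obtain K where "\<forall>N m. norm (phi_term a (b * q ^ N) q m) \<le> K * norm b ^ m"
    using phi_term_bound [OF q b] ..
  hence K: "norm (phi_term a (b * q ^ N) q m) \<le> K * norm b ^ m" for N m
    by blast
  have geometric: "(\<lambda>m. K * norm b ^ m) summable_on UNIV"
  proof (rule summable_on_cmult_right, rule norm_summable_imp_summable_on)
    show "summable (\<lambda>m. norm (norm b ^ m))"
      using b by (simp add: summable_geometric)
  qed
  have F: "(phi_term a (b * q ^ N) q has_sum F (b * q ^ N)) UNIV" for N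
  proof -
    have "(\<lambda>m. norm (phi_term a (b * q ^ N) q m)) summable_on UNIV"
      by (rule Infinite_Sum.abs_summable_on_comparison_test' [OF geometric K])
    thus ?thesis
      unfolding F_def by (rule has_sum_infsum [OF Infinite_Sum.abs_summable_summable])
  qed
  have step: "(1 - a * b * q ^ N) * F (b * q ^ N) = (1 - b * q ^ N) * F (b * q ^ Suc N)" for N
  proof -
    define c where "c = b * q ^ N"
    have c: "norm (a * c) < 1"
      using norm_mult_power_less_1 [OF q b(2), of N] by (simp add: c_def mult_ac)
    define t g where "t = phi_term a c q" and "g = (\<lambda>m. (1 - q ^ m) * t m)"
    have t: "t sums F c"
      using has_sum_imp_sums [OF F] by (simp add: t_def c_def)
    have "t \<longlonglongrightarrow> 0"
      using t summable_LIMSEQ_zero sums_summable by blast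
    moreover have "(\<lambda>m. q ^ m) \<longlonglongrightarrow> 0"
      using q by (rule LIMSEQ_power_zero)
    ultimately have "g \<longlonglongrightarrow> (1 - 0) * 0"
      unfolding g_def by (intro tendsto_mult tendsto_diff tendsto_const)
    hence "(\<lambda>m. g m - g (Suc m)) sums (g 0 - 0)"
      by (intro telescope_sums') simp
    from sums_mult [OF sums_diff [OF t this], of "1 - a * c"]
    have "(\<lambda>m. (1 - a * c) * (t m - (g m - g (Suc m)))) sums ((1 - a * c) * F c)"
      by (simp add: g_def)
    moreover have "(1 - a * c) * (t m - (g m - g (Suc m))) = (1 - c) * phi_term a (b * q ^ Suc N) q m" for m
      using phi_term_contiguous [OF q c, of m]
      by (simp add: g_def t_def c_def algebra_simps)
    ultimately have "(\<lambda>m. (1 - c) * phi_term a (b * q ^ Suc N) q m) sums ((1 - a * c) * F c)"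
      by simp
    moreover have "(\<lambda>m. (1 - c) * phi_term a (b * q ^ Suc N) q m) sums ((1 - c) * F (b * q ^ Suc N))"
      by (intro sums_mult has_sum_imp_sums F)
    ultimately have "(1 - a * c) * F c = (1 - c) * F (b * q ^ Suc N)"
      by (rule sums_unique2)
    thus ?thesis
      by (simp add: c_def mult_ac)
  qed
  have iterate: "qpoch (a * b) q N * F b = qpoch b q N * F (b * q ^ N)" for N
  proof (induction N)
    case (Suc N)
    have "qpoch (a * b) q (Suc N) * F b = (1 - a * b * q ^ N) * (qpoch (a * b) q N * F b)"
      by (simp add: qpoch_Suc mult_ac)
    also have "\<dots> = qpoch b q N * ((1 - a * b * q ^ N) * F (b * q ^ N))"
      unfolding Suc.IH by (simp only: mult_ac)
    finally show ?case
      unfolding step by (simp add: qpoch_Suc mult_ac)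
  qed simp
  have nz: "qpoch_inf b q \<noteq> 0" "qpoch_inf (a * b) q \<noteq> 0" "\<And>N. qpoch b q N \<noteq> 0"
    by (rule qpoch_inf_nonzero qpoch_nonzero; fact q b)+
  have "((\<lambda>m::nat. if m = 0 then 1 else 0) has_sum (qpoch_inf (a * b) q * F b / qpoch_inf b q)) UNIV"
  proof (rule has_sum_tannery [OF F])
    show "(\<lambda>m. K * norm b ^ m) summable_on UNIV"
      by (rule geometric)
    show "norm (phi_term a (b * q ^ N) q m) \<le> K * norm b ^ m" for N m
      by (rule K)
    have "F (b * q ^ N) = qpoch (a * b) q N * F b / qpoch b q N" for N
      using iterate [of N] nz(3) [of N] by (simp add: field_simps)
    moreover have "(\<lambda>N. qpoch (a * b) q N * F b / qpoch b q N) \<longlonglongrightarrow> qpoch_inf (a * b) q * F b / qpoch_inf b q"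
      using nz by (intro tendsto_intros qpoch_tendsto q)
    ultimately show "(\<lambda>N. F (b * q ^ N)) \<longlonglongrightarrow> qpoch_inf (a * b) q * F b / qpoch_inf b q"
      by simp
    show "(\<lambda>N. phi_term a (b * q ^ N) q m) \<longlonglongrightarrow> (if m = 0 then 1 else 0)" for m
    proof -
      have "(\<lambda>N. b * q ^ N) \<longlonglongrightarrow> b * 0"
        using q by (intro tendsto_intros LIMSEQ_power_zero)
      hence "(\<lambda>N. phi_term a (b * q ^ N) q m) \<longlonglongrightarrow> phi_term a 0 q m"
        unfolding phi_term_def qpoch_def
        using qpoch_nonzero [OF q q, of m] by (intro tendsto_intros) (auto simp: qpoch_def)
      thus ?thesis
        by (cases m) (simp_all add: phi_term_def binomial_eq_0)
    qed
  qed
  moreover have "((\<lambda>m::nat. if m = 0 then 1 else 0) has_sum (1::complex)) UNIV"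
    by (intro has_sum_finite_neutralI [of "{0}"]) auto
  ultimately have "qpoch_inf (a * b) q * F b / qpoch_inf b q = 1"
    using has_sum_unique by blast
  hence "F b = qpoch_inf b q / qpoch_inf (a * b) q"
    using nz by (simp add: field_simps)
  with F [of 0] show ?thesis
    by simp
qed

section \<open>Summation against the Bailey pair\<close>

text \<open>
  After the shift \<open>n = m + k\<close> this is the series \<open>1\<phi>1\<close> with \<open>a = -q^k\<close> and \<open>b = -q^(k+1)\<close>. The infinite
  products of its value differ from \<open>(-q)\<^sub>\<infinity>\<close> and \<open>(q)\<^sub>\<infinity>\<close> by finite initial segments, which cancel
  against the factors left over from the shift, by \<open>(-1)\<^sub>k (1 + q^k) = 2 (-q)\<^sub>k\<close>.
\<close>

lemma conjugate_bailey_pair: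
  assumes q: "norm q < 1"
  shows "((\<lambda>n. q ^ (Suc n choose 2) * qpoch (-1) q n
               * (inv_qfact q (int n - int k) * inv_qfact q (int n + int k)))
           has_sum (2 * q ^ (Suc k choose 2) / (1 + q ^ k) * (qpoch_inf (- q) q / qpoch_inf q q))) UNIV"
proof -
  define a b where "a = - (q ^ k)" and "b = - (q ^ Suc k)"
  have ab: "a * b = q * q ^ (2 * k)"
    by (simp add: a_def b_def flip: power_add mult_2)
  have "norm b < 1" "norm (a * b) < 1"
    using norm_mult_power_less_1 [OF q q, of k] norm_mult_power_less_1 [OF q q, of "2 * k"]
    unfolding ab by (simp_all add: b_def)
  from phi_1_1_sum [OF q this]
  have phi: "(phi_term a b q has_sum (qpoch_inf b q / qpoch_inf (a * b) q)) UNIV" .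
  define c where "c = q ^ (Suc k choose 2) * qpoch (-1) q k / qpoch q q (2 * k)"
  define f where "f = (\<lambda>n. q ^ (Suc n choose 2) * qpoch (-1) q n
               * (inv_qfact q (int n - int k) * inv_qfact q (int n + int k)))"
  have shifted: "f (m + k) = c * phi_term a b q m" for m
  proof -
    have "Suc (m + k) choose 2 = (Suc k choose 2) + Suc k * m + (m choose 2)"
      by (induction m) (simp_all add: numeral_2_eq_2)
    moreover have "qpoch (-1) q (m + k) = qpoch (-1) q k * qpoch a q m"
      using qpoch_add [of "-1" q k m] by (simp add: a_def add.commute)
    moreover have "inv_qfact q (int (m + k) - int k) = 1 / qpoch q q m"
      by simp
    moreover have "inv_qfact q (int (m + k) + int k) = 1 / (qpoch q q (2 * k) * qpoch (a * b) q m)"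
    proof -
      have "int (m + k) + int k = int (2 * k + m)"
        by simp
      thus ?thesis
        unfolding ab qpoch_add [symmetric] by (simp only: inv_qfact_of_nat)
    qed
    moreover have "(- b) ^ m = q ^ (Suc k * m)"
      by (simp only: b_def minus_minus power_mult)
    ultimately show ?thesis
      by (simp only: f_def c_def phi_term_def power_add) (simp add: mult_ac)
  qed
  have "((\<lambda>m. f (m + k)) has_sum (c * (qpoch_inf b q / qpoch_inf (a * b) q))) UNIV"
    unfolding shifted by (intro has_sum_cmult_right phi)
  hence "(f has_sum (c * (qpoch_inf b q / qpoch_inf (a * b) q))) (range (\<lambda>m. m + k))"
    by (subst has_sum_reindex) (auto simp: o_def)
  also have "?this \<longleftrightarrow> (f has_sum (c * (qpoch_inf b q / qpoch_inf (a * b) q))) UNIV"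
  proof (rule has_sum_cong_neutral)
    fix n assume "n \<in> UNIV - range (\<lambda>m. m + k)"
    hence "n < k"
      by (metis DiffD2 le_add_diff_inverse2 not_le rangeI)
    thus "f n = 0"
      by (simp add: f_def)
  qed auto
  also have "c * (qpoch_inf b q / qpoch_inf (a * b) q)
      = 2 * q ^ (Suc k choose 2) / (1 + q ^ k) * (qpoch_inf (- q) q / qpoch_inf q q)"
  proof -
    have nz: "qpoch q q (2 * k) \<noteq> 0" "qpoch_inf (a * b) q \<noteq> 0"
      by (rule qpoch_inf_nonzero qpoch_nonzero; fact)+
    have "1 + q ^ k \<noteq> 0"
    proof (cases k)
      case (Suc j)
      thus ?thesis
        using qpoch_factor_nonzero [of q "- q" j] q by simp
    qed auto
    have "qpoch (-1) q (Suc k) = 2 * qpoch (- q) q k"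
      using qpoch_add [of "-1" q 1 k] by (simp add: qpoch_Suc)
    hence "qpoch (-1) q k * (1 + q ^ k) = 2 * qpoch (- q) q k"
      by (simp add: qpoch_Suc)
    moreover have "qpoch_inf (- q) q = qpoch (- q) q k * qpoch_inf b q"
      using qpoch_inf_split [OF q, of "- q" k] by (simp add: b_def)
    ultimately have num: "qpoch (-1) q k * qpoch_inf b q = 2 * qpoch_inf (- q) q / (1 + q ^ k)"
      using \<open>1 + q ^ k \<noteq> 0\<close> by (simp add: eq_divide_eq mult_ac)
    have "qpoch_inf q q = qpoch q q (2 * k) * qpoch_inf (a * b) q"
      unfolding ab by (rule qpoch_inf_split [OF q])
    hence "c * (qpoch_inf b q / qpoch_inf (a * b) q)
             = q ^ (Suc k choose 2) * (qpoch (-1) q k * qpoch_inf b q) / qpoch_inf q q"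
      by (simp add: c_def)
    thus ?thesis
      unfolding num by simp
  qed
  finally show ?thesis
    by (simp only: f_def)
qed

text \<open>
  The factor \<open>1 + q^(2s)\<close> is the one that cancels against the conjugate pair. As the remaining exponent is
  non-negative, the form also yields the bound below.
\<close>

lemma bailey_alpha_eq:
  fixes r :: int
  assumes q: "q \<noteq> 0"
  defines "s \<equiv> nat \<bar>r\<bar>"
  shows "bailey_alpha q r = (-1) ^ s * q ^ (3 * s\<^sup>2 - s) * (1 + q ^ (2 * s)) / 2"
proof -
  have "bailey_alpha q r = (-1) ^ s * q ^ (3 * s\<^sup>2) * (q ^ s + 1 / q ^ s) / 2"
  proof -
    have sq: "q powi (3 * r\<^sup>2) = q ^ (3 * s\<^sup>2)"
    proof -
      have "3 * r\<^sup>2 = int (3 * s\<^sup>2)"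
        by (simp add: s_def)
      thus ?thesis
        by (simp only: power_int_of_nat)
    qed
    have "r = int s \<or> r = - int s"
      by (auto simp: s_def)
    hence "q powi r + q powi (- r) = q ^ s + 1 / q ^ s"
      by (auto simp: power_int_minus divide_inverse)
    moreover have "(-1) powi r = ((-1) ^ s :: complex)"
      by (cases "r \<ge> 0") (simp_all add: s_def power_int_def)
    ultimately show ?thesis
      by (simp only: bailey_alpha_def sq)
  qed
  also have "q ^ (3 * s\<^sup>2) = q ^ (3 * s\<^sup>2 - s) * q ^ s"
    by (subst power_add [symmetric]) (simp add: power2_eq_square)
  also have "(-1) ^ s * (q ^ (3 * s\<^sup>2 - s) * q ^ s) * (q ^ s + 1 / q ^ s) / 2
               = (-1) ^ s * q ^ (3 * s\<^sup>2 - s) * (q ^ s * (q ^ s + 1 / q ^ s)) / 2"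
    by (simp only: mult.assoc)
  also have "q ^ s * (q ^ s + 1 / q ^ s) = 1 + q ^ (2 * s)"
    using q by (simp add: distrib_left mult_2 power_add)
  finally show ?thesis .
qed

lemma norm_bailey_alpha_le:
  assumes q: "norm q < 1" "q \<noteq> 0"
  shows "norm (bailey_alpha q r) \<le> norm q ^ nat \<bar>r\<bar>"
proof -
  define s where "s = nat \<bar>r\<bar>"
  have "norm (1 + q ^ (2 * s)) \<le> 1 + norm (q ^ (2 * s))"
    by (metis norm_one norm_triangle_ineq)
  also have "\<dots> \<le> 2"
    using q by (simp add: norm_power power_le_one)
  finally have "norm (1 + q ^ (2 * s)) \<le> 2" .
  moreover have "norm q ^ (3 * s\<^sup>2 - s) \<le> norm q ^ s"
  proof (rule power_decreasing)
    show "s \<le> 3 * s\<^sup>2 - s"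
      using le_square [of s] unfolding power2_eq_square by linarith
  qed (use q in auto)
  ultimately have "norm q ^ (3 * s\<^sup>2 - s) * norm (1 + q ^ (2 * s)) \<le> norm q ^ s * 2"
    by (intro mult_mono) auto
  thus ?thesis
    unfolding bailey_alpha_eq [OF q(2)] s_def [symmetric] by (simp add: norm_mult norm_power)
qed

text \<open>
  What justifies the interchange of summations: the family is dominated by a constant times
  \<open>|q|^n * |q|^|r|\<close>.
\<close>

lemma summable_bailey_family:
  assumes q: "norm q < 1" "q \<noteq> 0"
  shows "(\<lambda>(n, r). q ^ (Suc n choose 2) * qpoch (-1) q n *
            (bailey_alpha q r * (inv_qfact q (int n - 2 * r) * inv_qfact q (int n + 2 * r))))
          summable_on (UNIV \<times> UNIV)"
proof -
  obtain M where M: "M > 0" "\<And>k. norm (inv_qfact q k) \<le> M"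
    using inv_qfact_bounded [OF q(1)] by blast
  obtain C where C: "C > 0" "\<And>n. norm (qpoch (-1) q n) \<le> C"
    using qpoch_bounded [OF q(1)] by blast
  have int: "(\<lambda>r::int. norm q ^ nat \<bar>r\<bar>) summable_on UNIV"
    using q by (intro summable_on_power_abs_int) auto
  have nat: "(\<lambda>n. norm q ^ n) summable_on (UNIV :: nat set)"
    using q by (intro norm_summable_imp_summable_on) (simp add: summable_geometric)
  have "(\<lambda>(n, r::int). norm q ^ n * C * (norm q ^ nat \<bar>r\<bar> * (M * M))) summable_on (UNIV \<times> UNIV)"
  proof (rule summable_on_SigmaI)
    show "((\<lambda>r::int. case (n, r) of (n, r) \<Rightarrow> norm q ^ n * C * (norm q ^ nat \<bar>r\<bar> * (M * M))) has_sum
            (norm q ^ n * C * ((\<Sum>\<^sub>\<infinity>r::int. norm q ^ nat \<bar>r\<bar>) * (M * M)))) UNIV" for n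
      using int by (auto intro!: has_sum_cmult_right has_sum_cmult_left has_sum_infsum)
    show "(\<lambda>n. norm q ^ n * C * ((\<Sum>\<^sub>\<infinity>r::int. norm q ^ nat \<bar>r\<bar>) * (M * M))) summable_on UNIV"
      using nat by (intro summable_on_cmult_left)
  qed (use C M in auto)
  hence "(\<lambda>p. norm (case p of (n, r) \<Rightarrow> q ^ (Suc n choose 2) * qpoch (-1) q n *
            (bailey_alpha q r * (inv_qfact q (int n - 2 * r) * inv_qfact q (int n + 2 * r)))))
          summable_on (UNIV \<times> UNIV)"
  proof (rule Infinite_Sum.abs_summable_on_comparison_test', clarify)
    fix n :: nat and r :: int
    have "norm q ^ (Suc n choose 2) \<le> norm q ^ n"
      using q by (intro power_decreasing) (auto simp: numeral_2_eq_2)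
    hence "norm (q ^ (Suc n choose 2)) \<le> norm q ^ n"
      by (simp only: norm_power)
    thus "norm (q ^ (Suc n choose 2) * qpoch (-1) q n *
            (bailey_alpha q r * (inv_qfact q (int n - 2 * r) * inv_qfact q (int n + 2 * r))))
          \<le> norm q ^ n * C * (norm q ^ nat \<bar>r\<bar> * (M * M))"
      unfolding norm_mult using C M norm_bailey_alpha_le [OF q, of r]
      by (intro mult_mono mult_nonneg_nonneg norm_ge_zero zero_le_power) (auto intro: less_imp_le)
  qed
  thus ?thesis
    by (rule Infinite_Sum.abs_summable_summable)
qed

text \<open>
  The double family is summed in both orders. Along \<open>r\<close> the Bailey pair yields the left-hand side;
  along \<open>n\<close> the conjugate pair at \<open>k = 2|r|\<close> yields a multiple of the terms of Gauss's theta series at \<open>x = q^5\<close>, where the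
  exponent \<open>5\<close> arises as \<open>(3s^2 - s) + (2s^2 + s) = 5s^2\<close> with \<open>s = |r|\<close>.
\<close>

lemma mod_10_identity_nonzero:
  assumes q: "norm q < 1" "q \<noteq> 0"
  shows "(\<lambda>n. q ^ (Suc n choose 2) * qpoch (-1) q n * (1 / (qpoch q (q\<^sup>2) n * qpoch q q n)))
    sums (qpoch_inf_list [q ^ 5, q ^ 5, q ^ 10] (q ^ 10) * (qpoch_inf (-q) q / qpoch_inf q q))"
proof -
  define F where "F = (\<lambda>(n, r). q ^ (Suc n choose 2) * qpoch (-1) q n *
            (bailey_alpha q r * (inv_qfact q (int n - 2 * r) * inv_qfact q (int n + 2 * r))))"
  define K where "K = qpoch_inf (- q) q / qpoch_inf q q"
  have "F summable_on (UNIV \<times> UNIV)"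
    unfolding F_def by (rule summable_bailey_family [OF q])
  then obtain S where S: "(F has_sum S) (UNIV \<times> UNIV)"
    by (auto simp: summable_on_def)
  have rows: "((\<lambda>n. q ^ (Suc n choose 2) * qpoch (-1) q n * (1 / (qpoch q (q\<^sup>2) n * qpoch q q n))) has_sum S) UNIV"
  proof (rule has_sum_SigmaD [OF S])
    show "((\<lambda>r. F (n, r)) has_sum
            (q ^ (Suc n choose 2) * qpoch (-1) q n * (1 / (qpoch q (q\<^sup>2) n * qpoch q q n)))) UNIV" for n
      unfolding F_def prod.case by (intro has_sum_cmult_right bailey_pair q)
  qed
  have "((\<lambda>r. (-1) powi r * (q ^ 5) powi r\<^sup>2 * K) has_sum S) UNIV"
  proof (rule has_sum_SigmaD)
    show "((\<lambda>(r, n). F (n, r)) has_sum S) (UNIV \<times> UNIV)"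
      using S by (subst (asm) has_sum_swap)
    fix r :: int
    define s where "s = nat \<bar>r\<bar>"
    have "((\<lambda>n. bailey_alpha q r * (q ^ (Suc n choose 2) * qpoch (-1) q n *
             (inv_qfact q (int n - int (2 * s)) * inv_qfact q (int n + int (2 * s))))) has_sum
           (bailey_alpha q r * (2 * q ^ (Suc (2 * s) choose 2) / (1 + q ^ (2 * s)) * K))) UNIV"
      unfolding K_def by (intro has_sum_cmult_right conjugate_bailey_pair q)
    also have "(\<lambda>n. bailey_alpha q r * (q ^ (Suc n choose 2) * qpoch (-1) q n *
             (inv_qfact q (int n - int (2 * s)) * inv_qfact q (int n + int (2 * s))))) = (\<lambda>n. F (n, r))"
      by (cases "r \<ge> 0") (simp_all add: F_def s_def mult_ac)
    also have "bailey_alpha q r * (2 * q ^ (Suc (2 * s) choose 2) / (1 + q ^ (2 * s)) * K)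
                 = (-1) powi r * (q ^ 5) powi r\<^sup>2 * K"
    proof -
      have "1 + q ^ (2 * s) \<noteq> 0"
      proof (cases "2 * s")
        case (Suc j)
        thus ?thesis
          using qpoch_factor_nonzero [of q "- q" j] q by simp
      qed auto
      hence "bailey_alpha q r * (2 * q ^ (Suc (2 * s) choose 2) / (1 + q ^ (2 * s)) * K)
               = (-1) ^ s * (q ^ (3 * s\<^sup>2 - s) * q ^ (Suc (2 * s) choose 2)) * K"
        unfolding bailey_alpha_eq [OF q(2)] s_def [symmetric] by simp
      also have "q ^ (3 * s\<^sup>2 - s) * q ^ (Suc (2 * s) choose 2) = (q ^ 5) ^ (s\<^sup>2)"
      proof -
        have "Suc (2 * s) choose 2 = 2 * s\<^sup>2 + s"
          by (simp add: choose_two power2_eq_square)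
        hence "3 * s\<^sup>2 - s + (Suc (2 * s) choose 2) = 5 * s\<^sup>2"
          by (simp add: power2_eq_square)
        thus ?thesis
          by (simp flip: power_add power_mult)
      qed
      also have "\<dots> = (q ^ 5) powi r\<^sup>2"
      proof -
        have "r\<^sup>2 = int (s\<^sup>2)"
          by (simp add: s_def)
        thus ?thesis
          by (simp only: power_int_of_nat)
      qed
      also have "(-1) ^ s = ((-1) powi r :: complex)"
        by (cases "r \<ge> 0") (simp_all add: s_def power_int_def)
      finally show ?thesis .
    qed
    finally show "((\<lambda>n. case (r, n) of (r, n) \<Rightarrow> F (n, r)) has_sum
                     ((-1) powi r * (q ^ 5) powi r\<^sup>2 * K)) UNIV"
      by simp
  qed
  moreover have "((\<lambda>r. (-1) powi r * (q ^ 5) powi r\<^sup>2 * K) has_sum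
                    (qpoch_inf (q ^ 5) ((q ^ 5)\<^sup>2) ^ 2 * qpoch_inf ((q ^ 5)\<^sup>2) ((q ^ 5)\<^sup>2) * K)) UNIV"
    using q by (intro has_sum_cmult_left gauss_theta) (auto simp: norm_power power_less_one_iff)
  ultimately have "S = qpoch_inf (q ^ 5) ((q ^ 5)\<^sup>2) ^ 2 * qpoch_inf ((q ^ 5)\<^sup>2) ((q ^ 5)\<^sup>2) * K"
    by (rule has_sum_unique)
  also have "\<dots> = qpoch_inf_list [q ^ 5, q ^ 5, q ^ 10] (q ^ 10) * K"
    by (simp add: qpoch_inf_list_def power2_eq_square flip: power_add)
  finally show ?thesis
    using has_sum_imp_sums [OF rows] by (simp add: K_def)
qed

theorem mainTheorem7:
  fixes q :: complex
  assumes "norm q < 1"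
  shows "(\<lambda>n. q ^ (n * (n + 1) div 2) * qpoch (-1) q n / (qpoch q (q\<^sup>2) n * qpoch q q n))
    sums (qpoch_inf_list [q ^ 5, q ^ 5, q ^ 10] (q ^ 10) * qpoch_inf (-q) q / qpoch_inf q q)"
proof -
  have half: "n * (n + 1) div 2 = Suc n choose 2" for n
    by (simp add: choose_two mult.commute)
  show ?thesis
  proof (cases "q = 0")
    case True
    have "(\<lambda>n. (0::complex) ^ (Suc n choose 2) * qpoch (-1) 0 n / (qpoch 0 (0\<^sup>2) n * qpoch 0 0 n))
            = (\<lambda>n. if n = 0 then 1 else 0)"
      by (auto simp: power_0_left fun_eq_iff)
    moreover have "qpoch_inf 0 x = 1" for x
      by (simp add: qpoch_inf_def)
    ultimately show ?thesis
      using sums_single [of 0 "\<lambda>_. 1 :: complex"] unfolding half True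
      by (simp add: qpoch_inf_list_def)
  next
    case False
    with mod_10_identity_nonzero [OF assms] show ?thesis
      unfolding half by simp
  qed
qed

end
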